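(* Let $d\geq 3$ be an odd integer, let $s\geq 2$, let $c_1,\dots,c_s\in\mathbb{Z}$ be distinct, and let $G=\langle x^d+c_1,\dots,x^d+c_s\rangle$ be the semigroup generated by these polynomials under composition. Assume that $f_1(x)=x^d+c_1$ is irreducible over $\mathbb{Q}$ and has a powered fixed point $y^p$ (that is, $f_1(y^p)=y^p$ with $y\in\mathbb{Q}$ and $p$ a prime dividing $d$), and that $f_2(x)=x^d+c_2$ satisfies $c_2\neq y^p$. Then the following statements hold: (1) If $c_2=0$, then $\{f_1^3\circ f_2\circ f_1\circ g: g\in G\}$ is a set of irreducible polynomials over $\mathbb{Q}$. (2) If $c_2\neq 0$, then $\{f_1^3\circ f_2^3\circ g: g\in G\}$ is a set of irreducible polynomials over $\mathbb{Q}$.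
   Context: For polynomials $f_1,\dots,f_s$, $\langle f_1,\dots,f_s\rangle$ denotes the set of all finite nonempty compositions of the $f_i$ (with repetition allowed), and $f^n$ denotes the $n$-th iterate (compositional power) of $f$. *)

theory Defs
  imports "HOL-Computational_Algebra.Computational_Algebra"
begin

definition unicritical :: "nat \<Rightarrow> int \<Rightarrow> rat poly" where
  "unicritical d c = monom 1 d + [:of_int c:]"

text \<open>The compositional power \<open>f^n\<close>; \<open>[:0, 1:]\<close> is the polynomial \<open>x\<close>.\<close>

definition pcompose_power :: "'a::comm_semiring_1 poly \<Rightarrow> nat \<Rightarrow> 'a poly" where
  "pcompose_power f n = (pcompose f ^^ n) [:0, 1:]"

text \<open>Only nonempty compositions are included, so the identity \<open>x\<close> is not
  adjoined.\<close>

inductive_set comp_semigroup :: "'a::comm_semiring_0 poly set \<Rightarrow> 'a poly set"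
  for S :: "'a poly set"
where
  generator: "f \<in> S \<Longrightarrow> f \<in> comp_semigroup S"
| comp: "f \<in> comp_semigroup S \<Longrightarrow> g \<in> comp_semigroup S \<Longrightarrow> pcompose f g \<in> comp_semigroup S"

end

theory Submission
  imports Defs "HOL-Number_Theory.Cong" "HOL-Computational_Algebra.Field_as_Ring"
begin

text \<open>
  Let \<open>F\<close> be monic and irreducible over \<open>\<rat>\<close> and let \<open>d\<close> be odd.  Then \<open>F(x\<^sup>d + c)\<close> is irreducible
  unless \<open>F(c)\<close> is a \<open>q\<close>-th power for some prime \<open>q\<close> dividing \<open>d\<close>
  (\<open>irreducible_pcompose_unicritical\<close>).  After a translation this concerns \<open>H(x\<^sup>q)\<close> with
  \<open>H(0) = F(c)\<close>: a proper factor \<open>A\<close> of \<open>H(x\<^sup>q)\<close> has a norm \<open>\<Prod>i<q. A(\<zeta>\<^sup>i x)\<close>, which is a rational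
  polynomial in \<open>x\<^sup>q\<close> and must be a power \<open>H(x\<^sup>q) ^ k\<close> with \<open>0 < k < q\<close>; its constant term shows
  that \<open>H(0)\<close> is a \<open>q\<close>-th power (\<open>irreducible_pcompose_prime_power\<close>).

  So if \<open>F\<close> is monic and irreducible and takes no \<open>q\<close>-th power as a value at an integer, then the
  same holds for \<open>F \<circ> g\<close> with \<open>g\<close> in the semigroup (\<open>irreducible_pcompose_semigroup\<close>).  It remains to
  study integer orbits.  The fixed point \<open>P = y\<^sup>p\<close> of \<open>f\<^sub>1\<close> is an integer, \<open>y\<close> is one too, and
  \<open>c\<^sub>1 = P - P\<^sup>d\<close> with \<open>\<bar>P\<bar> \<ge> 2\<close>.  Since distinct odd powers lie far apart (\<open>odd_power_gap\<close>),
  \<open>x\<^sup>d + c\<close> with \<open>c \<noteq> 0\<close> can be a \<open>q\<close>-th power only for small \<open>x\<close> (\<open>prime_power_value_bound\<close>),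
  while \<open>f\<^sub>1\<close> pushes every integer other than \<open>P\<close> far away.  Hence \<open>f\<^sub>1\<^sup>3(n)\<close> is a \<open>q\<close>-th power for no
  integer \<open>n \<noteq> P\<close> (\<open>third_iterate_not_prime_power\<close>).

  The fixed point itself is a \<open>p\<close>-th power and has to be avoided; this is the purpose of the inner
  maps.  If \<open>c\<^sub>2 = 0\<close>, then \<open>f\<^sub>2 \<circ> f\<^sub>1\<close> omits \<open>P\<close> (\<open>fixed_point_not_power_of_value\<close>).  If \<open>c\<^sub>2 \<noteq> 0\<close>, then
  \<open>f\<^sub>2\<^sup>3\<close> omits \<open>P\<close> because \<open>P\<close> is a \<open>p\<close>-th power but not a fixed point of \<open>f\<^sub>2\<close>
  (\<open>fixed_point_not_third_iterate\<close>).  The shorter compositions through which these two prefixes are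
  built up are treated by the same estimates, applied to the critical values \<open>c\<^sub>1\<close> and \<open>c\<^sub>2\<close> only.
\<close>

section \<open>Rational polynomials over the complex numbers\<close>

abbreviation cpoly :: "rat poly \<Rightarrow> complex poly" where
  "cpoly \<equiv> map_poly of_rat"

lemma cpoly_add: "cpoly (p + q) = cpoly p + cpoly q"
  by (rule poly_eqI) (simp add: coeff_map_poly of_rat_add)

lemma cpoly_mult: "cpoly (p * q) = cpoly p * cpoly q"
  by (rule poly_eqI) (simp add: coeff_map_poly coeff_mult of_rat_sum of_rat_mult)

lemma cpoly_pcompose: "cpoly (pcompose p q) = pcompose (cpoly p) (cpoly q)"
  by (induction p) (simp_all add: pcompose_pCons cpoly_add cpoly_mult map_poly_pCons)

lemma degree_cpoly: "degree (cpoly p) = degree p"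
  by (simp add: degree_map_poly)

lemma cpoly_eq_iff: "cpoly p = cpoly q \<longleftrightarrow> p = q"
  by (auto simp: poly_eq_iff coeff_map_poly)

text \<open>Choosing a rational preimage of every coefficient gives a sequence that
vanishes beyond the degree of \<open>B\<close> because \<open>of_rat\<close> is injective, hence a polynomial.\<close>

lemma rational_coeffs_imp_cpoly:
  assumes "\<And>n. coeff B n \<in> \<rat>"
  obtains p where "B = cpoly p"
proof -
  have "\<exists>r. \<forall>n. coeff B n = of_rat (r n)"
    using assms by (intro choice) (auto elim: Rats_cases)
  then obtain r where r: "\<And>n. coeff B n = of_rat (r n)" by blast
  have "B = cpoly (Abs_poly r)"
  proof (rule poly_eqI)
    fix n
    have "r i = 0" if "i > degree B" for i
      using r[of i] coeff_eq_0[OF that] by simp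
    then have "coeff (Abs_poly r) = r" by (rule coeff_Abs_poly)
    then show "coeff B n = coeff (cpoly (Abs_poly r)) n"
      by (simp add: r coeff_map_poly)
  qed
  then show ?thesis by (rule that)
qed

lemma pcompose_monom_left: "pcompose (monom c n) p = smult c (p ^ n)"
  by (simp add: pcompose_altdef map_poly_monom poly_monom)

lemma polynomial_in_power_of_x:
  fixes B :: "'a::comm_semiring_1 poly"
  assumes "q > 0" and "\<And>n. \<not> q dvd n \<Longrightarrow> coeff B n = 0"
  obtains N where "B = pcompose N (monom 1 q)"
proof
  define D where "D = degree B"
  have "pcompose (\<Sum>k\<le>D. monom (coeff B (q * k)) k) (monom 1 q) =
      (\<Sum>k\<le>D. monom (coeff B (q * k)) (q * k))"
    by (simp add: pcompose_sum pcompose_monom_left monom_power smult_monom)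
  also have "\<dots> = (\<Sum>n\<in>(*) q ` {..D}. monom (coeff B n) n)"
    using \<open>q > 0\<close> by (subst sum.reindex) (auto intro!: inj_onI)
  also have "\<dots> = (\<Sum>n\<le>q * D. monom (coeff B n) n)"
  proof (rule sum.mono_neutral_left)
    show "\<forall>n\<in>{..q * D} - (*) q ` {..D}. monom (coeff B n) n = 0"
    proof
      fix n assume n: "n \<in> {..q * D} - (*) q ` {..D}"
      have "\<not> q dvd n" using n \<open>q > 0\<close> by auto
      then show "monom (coeff B n) n = 0" by (simp add: assms(2))
    qed
  qed auto
  also have "\<dots> = B"
    using \<open>q > 0\<close> by (intro poly_as_sum_of_monoms') (simp add: D_def)
  finally show "B = pcompose (\<Sum>k\<le>D. monom (coeff B (q * k)) k) (monom 1 q)" ..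
qed

section \<open>The norm from polynomials in x to polynomials in a power of x\<close>

text \<open>The exponents that kill \<open>w\<close> are closed under Bezout combinations, so together
with \<open>q\<close> such an \<open>n\<close> would give \<open>w = 1\<close>.\<close>

lemma prime_root_of_unity_power_neq_1:
  fixes w :: "'a::field"
  assumes "prime q" "w ^ q = 1" "w \<noteq> 1" "\<not> q dvd n"
  shows "w ^ n \<noteq> 1"
proof
  assume "w ^ n = 1"
  have "n \<noteq> 0" using assms(4) by (metis dvd_0_right)
  moreover have "gcd n q = 1"
    using assms prime_imp_coprime[of q n] by (simp add: coprime_iff_gcd_eq_1 gcd.commute)
  ultimately obtain u v where uv: "n * u = q * v + 1"
    using bezout_nat[of n q] by auto
  have "1 = w ^ (n * u)" by (simp add: power_mult \<open>w ^ n = 1\<close>)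
  also have "\<dots> = w" by (simp add: uv power_add power_mult \<open>w ^ q = 1\<close>)
  finally show False using \<open>w \<noteq> 1\<close> by simp
qed

lemma sum_powers_root_of_unity_rational:
  fixes w :: complex
  assumes "w ^ q = 1"
  shows "(\<Sum>a<q. w ^ a) \<in> \<rat>"
proof (cases "w = 1")
  case False
  then show ?thesis using assms by (simp add: geometric_sum)
qed simp

text \<open>For a primitive \<open>q\<close>-th root of unity \<open>w\<close> this is the norm of \<open>A\<close> from the field of rational
  functions in \<open>x\<close> down to the field of rational functions in \<open>x ^ q\<close>: the factors are the
  conjugates of \<open>A\<close> under \<open>x \<mapsto> w * x\<close>.\<close>

definition rotation_product :: "nat \<Rightarrow> 'a::comm_ring_1 \<Rightarrow> 'a poly \<Rightarrow> 'a poly" where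
  "rotation_product q w A = (\<Prod>i<q. pcompose A [:0, w ^ i:])"

text \<open>What matters is that one rational polynomial \<open>r\<close> serves all \<open>w\<close> at once: the
coefficients of the norms formed with the different powers of a root of unity are then values of
the same \<open>r\<close>.\<close>

lemma coeff_rotation_product_polynomial:
  "\<exists>r. \<forall>w. coeff (rotation_product m w (cpoly A)) n = poly (cpoly r) w"
proof (induction m arbitrary: n)
  case 0
  have "coeff (rotation_product 0 w (cpoly A)) n = poly (cpoly (if n = 0 then 1 else 0)) w" for w
    by (auto simp: rotation_product_def coeff_1)
  then show ?case by blast
next
  case (Suc m)
  then obtain r where r: "\<And>n w. coeff (rotation_product m w (cpoly A)) n = poly (cpoly (r n)) w"
    by metis
  define s where "s = (\<lambda>j. r j * monom (coeff A (n - j)) (m * (n - j)))"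
  have cpoly_sum: "poly (cpoly (sum g S)) w = (\<Sum>j\<in>S. poly (cpoly (g j)) w)"
    if "finite S" for g :: "nat \<Rightarrow> rat poly" and S w
    using that by (induction rule: finite_induct) (simp_all add: cpoly_add)
  have "coeff (rotation_product (Suc m) w (cpoly A)) n = poly (cpoly (\<Sum>j\<le>n. s j)) w" for w
  proof -
    have "poly (cpoly (s j)) w =
        coeff (rotation_product m w (cpoly A)) j * coeff (pcompose (cpoly A) [:0, w ^ m:]) (n - j)"
      for j
      by (simp add: s_def r cpoly_mult map_poly_monom poly_monom coeff_pcompose_linear
          coeff_map_poly mult.commute flip: power_mult)
    moreover have "rotation_product (Suc m) w (cpoly A) =
        rotation_product m w (cpoly A) * pcompose (cpoly A) [:0, w ^ m:]"
      by (simp add: rotation_product_def)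
    ultimately show ?thesis
      by (simp add: cpoly_sum coeff_mult)
  qed
  then show ?case by blast
qed

text \<open>Replacing \<open>w\<close> by its Galois conjugate \<open>w ^ a\<close> only permutes the factors,
since \<open>i \<mapsto> a * i mod q\<close> permutes the residues.\<close>

lemma rotation_product_galois_invariant:
  fixes w :: complex
  assumes "w ^ q = 1" "coprime a q"
  shows "rotation_product q (w ^ a) A = rotation_product q w A"
proof (cases "q = 0")
  case False
  have mod: "w ^ (k mod q) = w ^ k" for k
  proof -
    have "w ^ k = w ^ (q * (k div q) + k mod q)" by simp
    also have "\<dots> = w ^ (k mod q)" by (simp only: power_add power_mult assms(1)) simp
    finally show ?thesis ..
  qed
  have inj: "inj_on (\<lambda>i. a * i mod q) {..<q}"
  proof (rule inj_onI)
    fix i j assume ij: "i \<in> {..<q}" "j \<in> {..<q}" "a * i mod q = a * j mod q"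
    then have "[a * i = a * j] (mod q)" by (simp add: cong_def)
    then have "[i = j] (mod q)" using assms(2) by (simp add: cong_mult_lcancel_nat)
    then show "i = j" using ij by (simp add: cong_def)
  qed
  moreover have "(\<lambda>i. a * i mod q) ` {..<q} = {..<q}"
    using False inj by (intro endo_inj_surj) auto
  ultimately have bij: "bij_betw (\<lambda>i. a * i mod q) {..<q} {..<q}"
    by (simp add: bij_betw_def)
  have "rotation_product q (w ^ a) A = (\<Prod>i<q. pcompose A [:0, w ^ (a * i mod q):])"
    by (simp add: rotation_product_def mod power_mult)
  also have "\<dots> = rotation_product q w A"
    unfolding rotation_product_def by (rule prod.reindex_bij_betw[OF bij])
  finally show ?thesis .
qed (simp add: rotation_product_def)

text \<open>This is the descent to \<open>\<rat>\<close> without Galois theory.  A coefficient of the norm does not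
change when \<open>w\<close> is replaced by \<open>w ^ a\<close> with \<open>1 \<le> a < q\<close>, so it equals its average over these
\<open>a\<close>.  Written as a rational polynomial in \<open>w\<close>, the average is a rational combination of sums
\<open>\<Sum>a = 1..<q. w ^ (k * a)\<close>, and each of these is rational, namely \<open>q - 1\<close> or \<open>- 1\<close>.\<close>

lemma rotation_product_rational:
  assumes "prime q" "w ^ q = 1"
  shows "coeff (rotation_product q w (cpoly A)) n \<in> \<rat>"
proof -
  obtain r where r: "\<And>w. coeff (rotation_product q w (cpoly A)) n = poly (cpoly r) w"
    using coeff_rotation_product_polynomial by blast
  define S where "S = {1..<q}"
  have "q \<ge> 2" using assms(1) by (rule prime_ge_2_nat)
  have "of_nat (q - 1) * coeff (rotation_product q w (cpoly A)) n =
      (\<Sum>a\<in>S. coeff (rotation_product q (w ^ a) (cpoly A)) n)"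
  proof -
    have "rotation_product q (w ^ a) (cpoly A) = rotation_product q w (cpoly A)" if "a \<in> S" for a
    proof -
      have "\<not> q dvd a" using that by (auto simp: S_def dest: dvd_imp_le)
      then have "coprime a q" using assms(1) prime_imp_coprime coprime_commute by blast
      then show ?thesis by (rule rotation_product_galois_invariant[OF assms(2)])
    qed
    then show ?thesis by (simp add: S_def)
  qed
  also have "\<dots> = (\<Sum>a\<in>S. \<Sum>k\<le>degree r. of_rat (coeff r k) * (w ^ k) ^ a)"
    by (simp add: r poly_altdef degree_cpoly coeff_map_poly mult.commute flip: power_mult)
  also have "\<dots> = (\<Sum>k\<le>degree r. of_rat (coeff r k) * (\<Sum>a\<in>S. (w ^ k) ^ a))"
    by (subst sum.swap) (simp add: sum_distrib_left)
  also have "\<dots> \<in> \<rat>"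
  proof (rule Rats_sum, rule Rats_mult)
    fix k
    have "(w ^ k) ^ q = 1"
      using assms(2) by (metis mult.commute power_mult power_one)
    then have "(\<Sum>a<q. (w ^ k) ^ a) \<in> \<rat>" by (rule sum_powers_root_of_unity_rational)
    moreover have "{..<q} = insert 0 S" using \<open>q \<ge> 2\<close> by (auto simp: S_def)
    ultimately have "1 + (\<Sum>a\<in>S. (w ^ k) ^ a) \<in> \<rat>" by (simp add: S_def)
    from Rats_diff[OF this Rats_1] show "(\<Sum>a\<in>S. (w ^ k) ^ a) \<in> \<rat>" by simp
  qed (rule Rats_of_rat)
  finally have "of_nat (q - 1) * coeff (rotation_product q w (cpoly A)) n / of_nat (q - 1) \<in> \<rat>"
    by (intro Rats_divide) auto
  then show ?thesis using \<open>q \<ge> 2\<close> by (simp add: of_nat_diff)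
qed

text \<open>The norm of \<open>A\<close>, regarded as a polynomial in \<open>x ^ q\<close>: its roots are the \<open>q\<close>-th powers of
the roots of \<open>A\<close>.  Rotating the variable by \<open>w\<close> permutes the factors cyclically and so fixes the
norm, which leaves only exponents divisible by \<open>q\<close>.  The leading coefficient is
\<open>w ^ (degree A * (q * (q - 1) div 2))\<close>, which is 1 because \<open>(q - 1) / 2\<close> is an integer; this is
where \<open>q\<close> must be odd.\<close>

lemma power_norm_exists:
  fixes A :: "rat poly"
  assumes q: "prime q" "odd q" and monic: "lead_coeff A = 1"
  obtains N where "lead_coeff N = 1" "degree N = degree A" "coeff N 0 = coeff A 0 ^ q"
    "\<And>t. poly (cpoly N) t = 0 \<Longrightarrow> \<exists>x. poly (cpoly A) x = 0 \<and> t = x ^ q"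
proof -
  have "q \<ge> 2" using q(1) by (rule prime_ge_2_nat)
  have "card {z::complex. z ^ q = 1} = q"
    using \<open>q \<ge> 2\<close> by (intro card_roots_unity_eq) auto
  moreover have "card {1::complex} = 1" by simp
  ultimately have "{z::complex. z ^ q = 1} \<noteq> {1}"
    using \<open>q \<ge> 2\<close> by auto
  then obtain w :: complex where w: "w ^ q = 1" "w \<noteq> 1" by auto
  have "w \<noteq> 0" using w(1) \<open>q \<ge> 2\<close> by (auto simp: power_0_left)
  have A0: "cpoly A \<noteq> 0" using monic by (auto simp: cpoly_eq_iff[of A 0, simplified])
  define B where "B = rotation_product q w (cpoly A)"
  obtain B' where B': "B = cpoly B'"
    using rotation_product_rational[OF q(1) w(1)] unfolding B_def
    by (rule rational_coeffs_imp_cpoly)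
  \<comment> \<open>The rotated product has the exponents 1 to \<open>q\<close> instead of 0 to \<open>q - 1\<close>, and
    \<open>w ^ q = w ^ 0\<close>.\<close>
  have "rotation_product q w (cpoly A) = pcompose B [:0, w:]"
  proof -
    define g where "g = (\<lambda>i. pcompose (cpoly A) [:0, w ^ i:])"
    have "pcompose B [:0, w:] = (\<Prod>i<q. g (Suc i))"
      by (simp add: B_def rotation_product_def pcompose_prod g_def pcompose_pCons mult.commute
          flip: pcompose_assoc)
    also have "\<dots> * g 0 = (\<Prod>i<Suc q. g i)"
      by (simp add: prod.lessThan_Suc_shift mult.commute del: prod.lessThan_Suc)
    also have "\<dots> = (\<Prod>i<q. g i) * g 0"
      by (simp add: g_def w(1))
    finally have "pcompose B [:0, w:] * g 0 = (\<Prod>i<q. g i) * g 0" .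
    then have "pcompose B [:0, w:] = (\<Prod>i<q. g i)"
      using A0 by (simp add: g_def)
    then show ?thesis
      by (simp add: rotation_product_def g_def)
  qed
  then have rot: "coeff B n = w ^ n * coeff B n" for n
    by (metis B_def coeff_pcompose_linear)
  have "coeff B' n = 0" if "\<not> q dvd n" for n
    using rot[of n] prime_root_of_unity_power_neq_1[OF q(1) w that]
    by (simp add: B' coeff_map_poly)
  then obtain N where N: "B' = pcompose N (monom 1 q)"
    using polynomial_in_power_of_x[of q B'] \<open>q \<ge> 2\<close> by auto
  have BN: "B = pcompose (cpoly N) (monom 1 q)"
    by (simp add: B' N cpoly_pcompose map_poly_monom)
  have degB: "degree B = q * degree A"
    using A0 \<open>w \<noteq> 0\<close> unfolding B_def rotation_product_def
    by (subst degree_prod_sum_eq) (auto simp: pcompose_eq_0_iff degree_pcompose degree_cpoly)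
  have lcB: "lead_coeff B = 1"
  proof -
    have "lead_coeff B = (\<Prod>i<q. (w ^ i) ^ degree A)"
      using monic \<open>w \<noteq> 0\<close>
      by (simp add: B_def rotation_product_def lead_coeff_prod degree_pcompose degree_cpoly
          coeff_pcompose_linear coeff_map_poly)
    also have "\<dots> = w ^ ((\<Sum>i<q. i) * degree A)"
      by (simp add: power_mult power_sum prod_power_distrib)
    also have "(\<Sum>i<q. i) = q * ((q - 1) div 2)"
    proof -
      have "(\<Sum>i<q. i) = q * (q - 1) div 2"
        by (simp add: Sum_Ico_nat flip: atLeast0LessThan)
      then show ?thesis using q(2) by (simp add: div_mult_swap)
    qed
    also have "w ^ (q * ((q - 1) div 2) * degree A) = 1"
      by (simp add: power_mult w(1))
    finally show ?thesis .
  qed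
  have degN: "degree N = degree A"
    using degB \<open>q \<ge> 2\<close> by (simp add: BN degree_pcompose degree_monom_eq degree_cpoly)
  show ?thesis
  proof
    have "lead_coeff B = lead_coeff (cpoly N)"
      using \<open>q \<ge> 2\<close> by (simp add: BN lead_coeff_comp degree_monom_eq)
    then show "lead_coeff N = 1"
      using lcB by (simp add: degree_cpoly coeff_map_poly)
    show "degree N = degree A" by (rule degN)
    have "poly B 0 = poly (cpoly N) 0"
      using \<open>q \<ge> 2\<close> by (simp add: BN poly_pcompose poly_monom power_0_left)
    moreover have "poly B 0 = poly (cpoly A) 0 ^ q"
      by (simp add: B_def rotation_product_def poly_prod poly_pcompose)
    ultimately have "(of_rat (coeff N 0) :: complex) = of_rat (coeff A 0 ^ q)"
      by (simp add: poly_0_coeff_0 coeff_map_poly of_rat_power)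
    then show "coeff N 0 = coeff A 0 ^ q" by simp
  next
    fix t assume t: "poly (cpoly N) t = 0"
    have "q > 0" using \<open>q \<ge> 2\<close> by simp
    have "\<not> constant (poly (monom 1 q + [:- t:]))"
    proof -
      have "degree (monom 1 q + [:- t:]) = q"
        using \<open>q > 0\<close> degree_add_eq_left[of "[:- t:]" "monom 1 q"]
        by (simp add: degree_monom_eq)
      then show ?thesis using \<open>q > 0\<close> by (simp add: constant_degree)
    qed
    then obtain x where "poly (monom 1 q + [:- t:]) x = 0"
      using fundamental_theorem_of_algebra by blast
    then have x: "x ^ q = t" by (simp add: poly_monom)
    then have "poly B x = 0" using t by (simp add: BN poly_pcompose poly_monom)
    then obtain i where "poly (cpoly A) (x * w ^ i) = 0"
      by (auto simp: B_def rotation_product_def poly_prod poly_pcompose)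
    moreover have "t = (x * w ^ i) ^ q"
    proof -
      have "(w ^ i) ^ q = 1" using w(1) by (metis mult.commute power_mult power_one)
      then show ?thesis by (simp add: x power_mult_distrib)
    qed
    ultimately show "\<exists>x. poly (cpoly A) x = 0 \<and> t = x ^ q" by blast
  qed
qed

section \<open>Irreducibility after substituting a power of the variable\<close>

text \<open>A root of \<open>N\<close> shared with \<open>H\<close> rules out a Bezout identity between them, so the
irreducible \<open>H\<close> divides \<open>N\<close>, and the quotient satisfies the same assumptions.\<close>

lemma monic_power_of_irreducible:
  fixes H N :: "rat poly"
  assumes H: "irreducible H" "lead_coeff H = 1" and "lead_coeff N = 1"
    and "\<And>t. poly (cpoly N) t = 0 \<Longrightarrow> poly (cpoly H) t = 0"
  shows "\<exists>k. N = H ^ k"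
  using assms(3,4)
proof (induction "degree N" arbitrary: N rule: less_induct)
  case less
  have degH: "degree H > 0"
    using H by (metis bot_nat_0.not_eq_extremum irreducible_def is_unit_iff_degree)
  show ?case
  proof (cases "degree N = 0")
    case True
    then have "N = H ^ 0" using less.prems(1) by (auto elim: degree_eq_zeroE)
    then show ?thesis by blast
  next
    case False
    then have "\<not> constant (poly (cpoly N))"
      by (simp add: constant_degree degree_cpoly)
    then obtain t where t: "poly (cpoly N) t = 0"
      using fundamental_theorem_of_algebra by blast
    have "H dvd N"
    proof (rule ccontr)
      assume "\<not> H dvd N"
      moreover have "prime_elem H" using H(1) by (rule field_poly_irreducible_imp_prime)
      ultimately have "coprime H N" by (simp add: prime_elem_imp_coprime)
      then obtain u v where "u * H + v * N = 1"
        by (metis bezout_coefficients_fst_snd coprime_imp_gcd_eq_1)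
      then have "cpoly u * cpoly H + cpoly v * cpoly N = 1"
        by (metis cpoly_add cpoly_mult map_poly_1' of_rat_1)
      then have "poly (cpoly u * cpoly H + cpoly v * cpoly N) t = poly 1 t" by simp
      then show False using t less.prems(2)[OF t] by simp
    qed
    then obtain M where M: "N = H * M" by auto
    have "M \<noteq> 0" "H \<noteq> 0" using M less.prems(1) by auto
    then have "degree M < degree N" using degH by (simp add: M degree_mult_eq)
    moreover have "lead_coeff M = 1" using less.prems(1) H(2) by (simp add: M lead_coeff_mult)
    moreover have "poly (cpoly H) t = 0" if "poly (cpoly M) t = 0" for t
      using that less.prems(2)[of t] by (simp add: M cpoly_mult)
    ultimately obtain k where "M = H ^ k" using less.hyps by blast
    then have "N = H ^ Suc k" by (simp add: M)
    then show ?thesis by blast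
  qed
qed

lemma monic_reducible_factorization:
  fixes F :: "'a::field poly"
  assumes "lead_coeff F = 1" "degree F > 0" "\<not> irreducible F"
  obtains A B where "F = A * B" "lead_coeff A = 1" "0 < degree A" "degree A < degree F"
proof -
  have "F \<noteq> 0" using assms(2) by auto
  moreover from this have "\<not> F dvd 1" using assms(2) is_unit_iff_degree[of F] by simp
  ultimately
  obtain a b where F: "F = a * b" and ab: "\<not> a dvd 1" "\<not> b dvd 1"
    using assms(3) by (auto simp: irreducible_def)
  have nz: "a \<noteq> 0" "b \<noteq> 0" using F \<open>F \<noteq> 0\<close> by auto
  have deg: "degree a > 0" "degree b > 0" using ab nz by (auto simp: is_unit_iff_degree)
  show ?thesis
  proof
    show "F = smult (inverse (lead_coeff a)) a * smult (lead_coeff a) b"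
      using nz by (simp add: F)
  qed (use nz deg in \<open>auto simp: F degree_mult_eq\<close>)
qed

lemma coprime_power_eq_imp_power:
  fixes x a :: "'a::field"
  assumes "x ^ k = a ^ q" "coprime k q" "k > 0" "x \<noteq> 0"
  shows "\<exists>r. x = r ^ q"
proof -
  obtain u v where uv: "k * u = q * v + 1"
    using bezout_nat[of k q] assms(2,3) by auto
  have "x ^ (q * v) * x = x ^ (k * u)" by (simp add: uv)
  also have "\<dots> = (a ^ u) ^ q" by (metis assms(1) mult.commute power_mult)
  finally have "x = (a ^ u / x ^ v) ^ q"
    using \<open>x \<noteq> 0\<close> by (simp add: power_divide field_simps flip: power_mult)
  then show ?thesis by blast
qed

text \<open>If \<open>A\<close> is a proper factor of \<open>H(x\<^sup>q)\<close>, then every root of its norm \<open>N\<close> is a root of the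
irreducible \<open>H\<close>, so \<open>N = H ^ k\<close>, and comparing degrees gives \<open>0 < k < q\<close>.  The constant terms
satisfy \<open>H(0) ^ k = A(0) ^ q\<close>, and since \<open>k\<close> is prime to \<open>q\<close>, this makes \<open>H(0)\<close> a \<open>q\<close>-th power.\<close>

lemma irreducible_pcompose_prime_power:
  fixes H :: "rat poly"
  assumes H: "irreducible H" "lead_coeff H = 1" and q: "prime q" "odd q"
    and nonpower: "\<And>r. coeff H 0 \<noteq> r ^ q"
  shows "irreducible (pcompose H (monom 1 q))"
proof (rule ccontr)
  assume red: "\<not> irreducible (pcompose H (monom 1 q))"
  have "q \<ge> 2" using q(1) by (rule prime_ge_2_nat)
  have degH: "degree H > 0"
    using H by (metis bot_nat_0.not_eq_extremum irreducible_def is_unit_iff_degree)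
  have deg: "degree (pcompose H (monom 1 q)) = degree H * q"
    by (simp add: degree_pcompose degree_monom_eq)
  have monic: "lead_coeff (pcompose H (monom 1 q)) = 1"
    using \<open>q \<ge> 2\<close> H(2) by (subst lead_coeff_comp) (simp_all add: degree_monom_eq)
  have "degree (pcompose H (monom 1 q)) > 0"
    using deg degH \<open>q \<ge> 2\<close> by simp
  then obtain A B where AB: "pcompose H (monom 1 q) = A * B" "lead_coeff A = 1"
      "0 < degree A" "degree A < degree H * q"
    using monic_reducible_factorization[OF monic _ red] deg by metis
  obtain N where N: "lead_coeff N = 1" "degree N = degree A" "coeff N 0 = coeff A 0 ^ q"
    "\<And>t. poly (cpoly N) t = 0 \<Longrightarrow> \<exists>x. poly (cpoly A) x = 0 \<and> t = x ^ q"
    using power_norm_exists[OF q AB(2)] by blast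
  have "poly (cpoly H) t = 0" if root: "poly (cpoly N) t = 0" for t
  proof -
    obtain x where x: "poly (cpoly A) x = 0" "t = x ^ q" using N(4)[OF root] by blast
    have "poly (cpoly (pcompose H (monom 1 q))) x = 0"
      using x(1) by (simp add: AB(1) cpoly_mult)
    then show ?thesis by (simp add: cpoly_pcompose map_poly_monom poly_pcompose poly_monom x(2))
  qed
  then obtain k where k: "N = H ^ k"
    using monic_power_of_irreducible[OF H N(1)] by blast
  have "degree A = k * degree H"
    using N(2) H(2) degree_power_eq[of H k] k by force
  then have "0 < k" "k < q" using AB(3,4) by (auto simp: mult.commute)
  then have "coprime k q"
    using q(1) by (metis coprime_commute dvd_imp_le leD prime_imp_coprime)
  moreover have "coeff H 0 ^ k = coeff A 0 ^ q"
    using N(3) by (simp add: k coeff_0_power)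
  moreover have "coeff H 0 \<noteq> 0"
    using nonpower[of 0] \<open>q \<ge> 2\<close> by (simp add: power_0_left)
  ultimately have "\<exists>r. coeff H 0 = r ^ q"
    using \<open>0 < k\<close> by (intro coprime_power_eq_imp_power)
  then show False using nonpower by blast
qed

text \<open>The substitution \<open>x \<mapsto> x ^ q\<close> keeps the constant term, so the criterion for primes can be
applied to the prime factors of \<open>d\<close> one after the other, always with the same hypothesis.\<close>

lemma irreducible_pcompose_power:
  fixes H :: "rat poly"
  assumes "irreducible H" "lead_coeff H = 1" "odd d"
    and "\<And>q r. prime q \<Longrightarrow> q dvd d \<Longrightarrow> coeff H 0 \<noteq> r ^ q"
  shows "irreducible (pcompose H (monom 1 d))"
  using assms
proof (induction d arbitrary: H rule: less_induct)
  case (less d)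
  show ?case
  proof (cases "d = 1")
    case True
    then show ?thesis using less.prems(1) by (simp add: monom_Suc monom_0)
  next
    case False
    then obtain q where q: "prime q" "q dvd d" by (metis prime_factor_nat)
    then obtain e where d: "d = q * e" by auto
    have "q \<ge> 2" using q(1) by (rule prime_ge_2_nat)
    define H' where "H' = pcompose H (monom 1 q)"
    have odd: "odd q" "odd e" using less.prems(3) d by auto
    have "e < d" using odd \<open>q \<ge> 2\<close> using n_less_m_mult_n[of e q] by (simp add: d odd_pos)
    moreover have "irreducible H'"
      unfolding H'_def using less.prems q odd by (intro irreducible_pcompose_prime_power) auto
    moreover have "lead_coeff H' = 1"
      using \<open>q \<ge> 2\<close> less.prems(2) unfolding H'_def
      by (subst lead_coeff_comp) (simp_all add: degree_monom_eq)
    moreover have "coeff H' 0 = coeff H 0"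
      using \<open>q \<ge> 2\<close> by (simp add: H'_def pcompose_coeff_0 poly_0_coeff_0)
    ultimately have "irreducible (pcompose H' (monom 1 e))"
      using less.prems d odd by (intro less.IH) auto
    moreover have "pcompose (monom 1 q) (monom 1 e) = (monom 1 d :: rat poly)"
      by (simp add: pcompose_monom_left monom_power d mult.commute)
    ultimately show ?thesis by (simp add: H'_def flip: pcompose_assoc)
  qed
qed

lemma irreducible_pcompose_translation:
  fixes F :: "'a::field poly"
  assumes "irreducible F"
  shows "irreducible (pcompose F [:c, 1:])"
proof (rule irreducibleI)
  have inv: "pcompose (pcompose p [:c, 1:]) [:-c, 1:] = p" "pcompose (pcompose p [:-c, 1:]) [:c, 1:] = p"
    for p :: "'a poly" by (simp_all add: pcompose_pCons flip: pcompose_assoc)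
  have unit: "pcompose p [:b, 1:] dvd 1 \<longleftrightarrow> p dvd 1" for p :: "'a poly" and b
  proof (cases "p = 0")
    case False
    then have "pcompose p [:b, 1:] \<noteq> 0" by (simp add: pcompose_eq_0_iff)
    with False show ?thesis by (simp add: is_unit_iff_degree degree_pcompose)
  qed simp
  show "pcompose F [:c, 1:] \<noteq> 0"
    using assms inv(1)[of F] by auto
  show "\<not> pcompose F [:c, 1:] dvd 1"
    using assms by (simp add: unit irreducible_not_unit)
  fix a b assume "pcompose F [:c, 1:] = a * b"
  then have "F = pcompose a [:-c, 1:] * pcompose b [:-c, 1:]"
    by (metis inv(1) pcompose_mult)
  then show "a dvd 1 \<or> b dvd 1"
    using irreducibleD[OF assms, of "pcompose a [:-c, 1:]" "pcompose b [:-c, 1:]"] by (simp add: unit)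
qed

section \<open>Gaps between odd powers\<close>

text \<open>For odd \<open>n\<close> the power function is strictly monotone on all integers, so the \<open>n\<close>-th power nearest
to \<open>a ^ n\<close> belongs to a neighbour of \<open>a\<close>; for even \<open>n\<close> the case \<open>b = - a\<close> would be an exception.
The extra summand \<open>\<bar>a\<bar>\<close> absorbs the linear terms in the estimates on orbits below.\<close>

lemma odd_power_gap:
  fixes a b :: int
  assumes "odd n" "n \<ge> 3" "a \<noteq> b" "\<bar>a\<bar> \<ge> 2"
  shows "\<bar>a\<bar> ^ (n - 1) + \<bar>a\<bar> \<le> \<bar>a ^ n - b ^ n\<bar>"
proof -
  have pos: "a ^ (n - 1) + a \<le> \<bar>a ^ n - b ^ n\<bar>" if "a \<ge> 2" "a \<noteq> b" for a b :: int
  proof -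
    obtain m where n: "n = m + 3"
      using \<open>n \<ge> 3\<close> by (metis add.commute le_Suc_ex)
    show ?thesis
    proof (cases "b \<le> a - 1")
      case True
      have "b ^ n \<le> (a - 1) ^ n"
        using True \<open>odd n\<close> by (simp add: power_mono_odd)
      also have "\<dots> = (a - 1)\<^sup>2 * (a - 1) ^ (m + 1)"
        by (simp add: n eval_nat_numeral)
      also have "\<dots> \<le> (a - 1)\<^sup>2 * a ^ (m + 1)"
        using that by (intro mult_left_mono power_mono) auto
      also have "\<dots> = a ^ n - a ^ (n - 1) - a ^ (m + 1) * (a - 1)"
        by (simp add: n eval_nat_numeral algebra_simps)
      finally have "b ^ n + a ^ (n - 1) + a ^ (m + 1) * (a - 1) \<le> a ^ n"
        by simp
      moreover have "a * 1 \<le> a ^ (m + 1) * (a - 1)"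
        using that self_le_power[of a "m + 1"] by (intro mult_mono) auto
      ultimately show ?thesis by simp
    next
      case False
      have "a ^ n + (a ^ (n - 1) + a) \<le> a * (a + 1) ^ (n - 1) + (a + 1) ^ (n - 1)"
      proof -
        have "a * (a + 1) ^ (n - 1) \<ge> a * a ^ (n - 1)"
          using that by (intro mult_left_mono power_mono) auto
        moreover have "(a + 1) ^ (n - 1) = a * (a + 1) ^ (m + 1) + (a + 1) ^ (m + 1)"
          by (simp add: n algebra_simps)
        moreover have "a * (a + 1) ^ (m + 1) \<ge> a * a ^ (m + 1)"
          using that by (intro mult_left_mono power_mono) auto
        moreover have "(a + 1) ^ (m + 1) \<ge> a + 1"
          using that by (intro self_le_power) auto
        moreover have "a ^ n = a * a ^ (n - 1)" "a ^ (n - 1) = a * a ^ (m + 1)"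
          by (simp_all add: n eval_nat_numeral)
        ultimately show ?thesis by linarith
      qed
      also have "\<dots> = (a + 1) * (a + 1) ^ (n - 1)"
        by (simp only: distrib_right mult_1)
      also have "\<dots> = (a + 1) ^ n"
        using n by (simp add: eval_nat_numeral)
      also have "\<dots> \<le> b ^ n"
        using False that \<open>odd n\<close> by (simp add: power_mono_odd)
      finally show ?thesis by simp
    qed
  qed
  show ?thesis
  proof (cases "a \<ge> 0")
    case True
    then show ?thesis using pos[of a b] assms by simp
  next
    case False
    then have "(- a) ^ (n - 1) + (- a) \<le> \<bar>(- a) ^ n - (- b) ^ n\<bar>"
      using assms by (intro pos) auto
    then show ?thesis using False \<open>odd n\<close> by (simp add: power_minus_odd)
  qed
qed

lemma odd_power_gap_square:
  fixes a b :: int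
  assumes "odd n" "n \<ge> 3" "a \<noteq> b" "\<bar>a\<bar> \<ge> 2"
  shows "a\<^sup>2 + \<bar>a\<bar> \<le> \<bar>a ^ n - b ^ n\<bar>"
proof -
  have "\<bar>a\<bar> ^ 2 \<le> \<bar>a\<bar> ^ (n - 1)"
    using assms by (intro power_increasing) auto
  with odd_power_gap[OF assms] show ?thesis by simp
qed

text \<open>Since \<open>q\<close> divides \<open>d\<close>, the number \<open>c = z ^ q - x ^ d\<close> is a difference of two \<open>q\<close>-th powers.  It is
nonzero, so it is at least as large as the gap next to either of them.  Thus \<open>x ^ d + c\<close> can be a
\<open>q\<close>-th power only for \<open>x\<close> of size at most about \<open>sqrt \<bar>c\<bar>\<close>.\<close>

lemma prime_power_value_bound:
  fixes x z c :: int
  assumes "odd d" "prime q" "q dvd d" "x ^ d + c = z ^ q" "c \<noteq> 0"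
  shows "\<bar>x\<bar> \<ge> 2 \<Longrightarrow> x\<^sup>2 + \<bar>x\<bar> \<le> \<bar>c\<bar>"
    and "\<bar>z\<bar> \<ge> 2 \<Longrightarrow> x\<^sup>2 + \<bar>x\<bar> \<le> \<bar>c\<bar>"
    and "\<bar>z\<bar> \<ge> 2 \<Longrightarrow> 6 \<le> \<bar>c\<bar>"
proof -
  obtain e where d: "d = e * q" using \<open>q dvd d\<close> by (metis dvd_def mult.commute)
  have q: "odd q" "q \<ge> 3" "e > 0"
    using assms d prime_ge_2_nat[of q] by (auto simp: le_less odd_pos)
  define w where "w = x ^ e"
  have c: "c = z ^ q - w ^ q"
    using assms(4) by (simp add: w_def d power_mult)
  with \<open>c \<noteq> 0\<close> have "w \<noteq> z" by auto
  show large: "x\<^sup>2 + \<bar>x\<bar> \<le> \<bar>c\<bar>" if "\<bar>x\<bar> \<ge> 2"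
  proof -
    have "\<bar>x\<bar> \<le> \<bar>w\<bar>"
      using that \<open>e > 0\<close> by (simp add: w_def power_abs self_le_power)
    moreover from this have "x\<^sup>2 \<le> w\<^sup>2" by (simp add: abs_le_square_iff)
    moreover have "w\<^sup>2 + \<bar>w\<bar> \<le> \<bar>w ^ q - z ^ q\<bar>"
      using q \<open>w \<noteq> z\<close> that calculation(1) by (intro odd_power_gap_square) auto
    ultimately show ?thesis by (simp add: c abs_minus_commute)
  qed
  show 6: "6 \<le> \<bar>c\<bar>" if "\<bar>z\<bar> \<ge> 2"
  proof -
    have "z\<^sup>2 + \<bar>z\<bar> \<le> \<bar>z ^ q - w ^ q\<bar>"
      using q \<open>w \<noteq> z\<close> that by (intro odd_power_gap_square) auto
    moreover have "2\<^sup>2 \<le> z\<^sup>2"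
      using that abs_le_square_iff[of 2 z] by simp
    ultimately show ?thesis using that by (simp add: c)
  qed
  show "x\<^sup>2 + \<bar>x\<bar> \<le> \<bar>c\<bar>" if "\<bar>z\<bar> \<ge> 2"
  proof (cases "\<bar>x\<bar> \<ge> 2")
    case False
    then have "x\<^sup>2 \<le> 1" using abs_le_square_iff[of x 1] by simp
    then show ?thesis using 6[OF that] False by linarith
  qed (rule large)
qed

section \<open>Prime powers and fixed points in integer orbits\<close>

lemma fixed_point_size:
  fixes P :: int
  assumes "d \<ge> 3" "\<bar>P\<bar> \<ge> 2"
  shows "4 * \<bar>P\<bar> \<le> \<bar>P\<bar> ^ d" "P - P ^ d \<noteq> 0"
    "3 * \<bar>P\<bar> \<le> \<bar>P - P ^ d\<bar>" "\<bar>P - P ^ d\<bar> \<le> \<bar>P\<bar> ^ d + \<bar>P\<bar>"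
proof -
  have "2 ^ 2 \<le> \<bar>P\<bar> ^ 2" using assms by (intro power_mono) auto
  also have "\<dots> \<le> \<bar>P\<bar> ^ (d - 1)" using assms by (intro power_increasing) auto
  finally have "4 * \<bar>P\<bar> \<le> \<bar>P\<bar> ^ (d - 1) * \<bar>P\<bar>" by (intro mult_right_mono) auto
  also have "\<dots> = \<bar>P\<bar> ^ d" using assms by (cases d) auto
  finally show 1: "4 * \<bar>P\<bar> \<le> \<bar>P\<bar> ^ d" .
  moreover have "\<bar>P ^ d\<bar> \<le> \<bar>P - P ^ d\<bar> + \<bar>P\<bar>" by simp
  ultimately show 2: "3 * \<bar>P\<bar> \<le> \<bar>P - P ^ d\<bar>" by (simp add: power_abs)
  show "\<bar>P - P ^ d\<bar> \<le> \<bar>P\<bar> ^ d + \<bar>P\<bar>"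
    using abs_triangle_ineq4[of P "P ^ d"] by (simp add: power_abs)
  show "P - P ^ d \<noteq> 0" using 2 assms by auto
qed

text \<open>Let \<open>c = P - P ^ d\<close>.  Since \<open>f n - P = n ^ d - P ^ d\<close>, every integer \<open>n \<noteq> P\<close> is mapped far away
from the fixed point, \<open>\<bar>f n\<bar> \<ge> P\<^sup>2\<close>; the next iterate exceeds \<open>\<bar>c\<bar> \<approx> \<bar>P\<bar> ^ d\<close>, and one more value
is then no prime power because its argument is too large.\<close>

lemma third_iterate_not_prime_power:
  fixes P n z :: int and d q :: nat
  defines "f \<equiv> \<lambda>x. x ^ d + (P - P ^ d)"
  assumes d: "odd d" "d \<ge> 3" and P: "\<bar>P\<bar> \<ge> 2" and "n \<noteq> P"
    and q: "prime q" "q dvd d"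
  shows "f (f (f n)) \<noteq> z ^ q"
proof
  define c where "c = P - P ^ d"
  define T where "T = \<bar>P\<bar> ^ d"
  note size = fixed_point_size[OF \<open>d \<ge> 3\<close> P, folded c_def T_def]
  assume "f (f (f n)) = z ^ q"
  then have eq: "f (f n) ^ d + c = z ^ q" by (simp add: f_def c_def)
  have "\<bar>P\<bar> ^ (d - 1) + \<bar>P\<bar> \<le> \<bar>P ^ d - n ^ d\<bar>"
    using d P \<open>n \<noteq> P\<close> by (intro odd_power_gap) auto
  moreover have "\<bar>P\<bar> ^ 2 \<le> \<bar>P\<bar> ^ (d - 1)"
    using d P by (intro power_increasing) auto
  moreover have "\<bar>P ^ d - n ^ d\<bar> \<le> \<bar>f n\<bar> + \<bar>P\<bar>"
    by (simp add: f_def)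
  ultimately have "\<bar>P\<bar> ^ 2 \<le> \<bar>f n\<bar>" by linarith
  then have "(\<bar>P\<bar> ^ 2) ^ d \<le> \<bar>f n\<bar> ^ d" by (intro power_mono) auto
  then have "T * T \<le> \<bar>f n ^ d\<bar>"
    by (simp add: T_def power_abs power2_eq_square flip: power_mult_distrib)
  moreover have "8 * T \<le> T * T"
    using size P by (intro mult_right_mono) auto
  moreover have "\<bar>f n ^ d\<bar> \<le> \<bar>f (f n)\<bar> + \<bar>c\<bar>"
    by (simp add: f_def c_def)
  ultimately have large: "\<bar>f (f n)\<bar> > \<bar>c\<bar>" "\<bar>f (f n)\<bar> \<ge> 2"
    using size P by linarith+
  have "\<bar>f (f n)\<bar> \<le> \<bar>c\<bar>"
    using prime_power_value_bound(1)[OF \<open>odd d\<close> q eq size(2) large(2)]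
      zero_le_power2[of "f (f n)"] by linarith
  with large(1) show False by simp
qed

lemma critical_value_not_prime_power:
  fixes c z :: int and d q :: nat
  assumes "odd d" "\<bar>c\<bar> \<ge> 2 \<or> \<bar>z\<bar> \<ge> 2" "c \<noteq> 0" "prime q" "q dvd d"
  shows "c ^ d + c \<noteq> z ^ q"
proof
  assume "c ^ d + c = z ^ q"
  from prime_power_value_bound(1,2)[OF assms(1,4,5) this \<open>c \<noteq> 0\<close>] assms(2)
  have "c\<^sup>2 + \<bar>c\<bar> \<le> \<bar>c\<bar>" by auto
  with \<open>c \<noteq> 0\<close> show False by simp
qed

text \<open>If \<open>u ^ d = P\<close> with \<open>u = m ^ d + (P - P ^ d)\<close>, then \<open>m ^ d\<close> and \<open>P ^ d\<close> differ by \<open>u - P\<close>, which is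
too small for a gap between \<open>d\<close>-th powers as \<open>\<bar>u\<bar> \<le> \<bar>P\<bar>\<close>, and nonzero as \<open>P ^ d \<noteq> P\<close>.\<close>

lemma fixed_point_not_power_of_value:
  fixes P m :: int
  assumes d: "odd d" "d \<ge> 3" and P: "\<bar>P\<bar> \<ge> 2"
  shows "(m ^ d + (P - P ^ d)) ^ d \<noteq> P"
proof
  define u where "u = m ^ d + (P - P ^ d)"
  assume "(m ^ d + (P - P ^ d)) ^ d = P"
  then have u: "u ^ d = P" by (simp add: u_def)
  have "m \<noteq> P"
    using u fixed_point_size(2)[OF d(2) P] by (auto simp: u_def)
  then have "P\<^sup>2 + \<bar>P\<bar> \<le> \<bar>P ^ d - m ^ d\<bar>"
    using d P by (intro odd_power_gap_square) auto
  also have "\<dots> = \<bar>P - u\<bar>" by (simp add: u_def)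
  also have "\<bar>P - u\<bar> \<le> \<bar>P\<bar> + \<bar>u\<bar>" by simp
  finally have "P\<^sup>2 \<le> \<bar>u\<bar>" by simp
  moreover have "\<bar>u\<bar> \<le> \<bar>P\<bar>"
  proof (cases "u = 0")
    case False
    then have "\<bar>u\<bar> \<le> \<bar>u\<bar> ^ d" using d by (intro self_le_power) auto
    then show ?thesis by (simp flip: u add: power_abs)
  qed simp
  moreover have "2 * \<bar>P\<bar> \<le> P\<^sup>2"
    using mult_right_mono[OF P, of "\<bar>P\<bar>"] by (simp add: power2_eq_square)
  ultimately show False using P by linarith
qed

text \<open>Put \<open>v = f m\<close> and \<open>u = f v\<close>.  If \<open>f u = y ^ p\<close>, then \<open>\<bar>c\<bar> \<ge> u\<^sup>2 + \<bar>u\<bar>\<close>, because a prime power is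
attained at \<open>u\<close>.  On the other hand \<open>m ^ d - v ^ d = v - u\<close>; unless \<open>m = v\<close>, which would make \<open>m\<close> and
hence \<open>y ^ p\<close> a fixed point, the gap forces \<open>\<bar>u\<bar> \<ge> M ^ (d - 1)\<close> for \<open>M = max \<bar>m\<bar> \<bar>v\<bar>\<close>.  Then \<open>u\<^sup>2\<close>
exceeds \<open>M ^ d\<close>, against \<open>\<bar>c\<bar> = \<bar>u - v ^ d\<bar> \<le> \<bar>u\<bar> + M ^ d\<close>.  This needs \<open>M \<ge> 2\<close>; for smaller \<open>M\<close>
already \<open>c = v - m ^ d\<close> is too small.\<close>

lemma fixed_point_not_third_iterate:
  fixes c m y :: int and d p :: nat
  defines "f \<equiv> \<lambda>x. x ^ d + c"
  assumes d: "odd d" "d \<ge> 3" and y: "\<bar>y\<bar> \<ge> 2" and p: "prime p" "p dvd d"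
    and "c \<noteq> 0" and not_fixed: "f (y ^ p) \<noteq> y ^ p"
  shows "f (f (f m)) \<noteq> y ^ p"
proof
  define v where "v = f m"
  define u where "u = f v"
  assume "f (f (f m)) = y ^ p"
  then have P: "u ^ d + c = y ^ p" by (simp add: u_def v_def f_def)
  have bound: "u\<^sup>2 + \<bar>u\<bar> \<le> \<bar>c\<bar>" "6 \<le> \<bar>c\<bar>"
    using prime_power_value_bound(2,3)[OF d(1) p P \<open>c \<noteq> 0\<close>] y by auto
  have "v \<noteq> m"
    using P not_fixed by (auto simp: u_def v_def f_def)
  define M where "M = max \<bar>m\<bar> \<bar>v\<bar>"
  have "M \<ge> 2"
  proof (rule ccontr)
    assume "\<not> M \<ge> 2"
    then have "\<bar>m\<bar> \<le> 1" "\<bar>v\<bar> \<le> 1" by (auto simp: M_def)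
    moreover from this have "\<bar>m ^ d\<bar> \<le> 1" by (simp add: power_abs power_le_one)
    ultimately show False using bound(2) by (simp add: v_def f_def)
  qed
  have "M ^ (d - 1) + M \<le> \<bar>m ^ d - v ^ d\<bar>"
  proof (cases "M = \<bar>m\<bar>")
    case True
    then show ?thesis
      using odd_power_gap[of d m v] d \<open>v \<noteq> m\<close> \<open>M \<ge> 2\<close> by simp
  next
    case False
    then have "M = \<bar>v\<bar>" by (auto simp: M_def)
    then show ?thesis
      using odd_power_gap[of d v m] d \<open>v \<noteq> m\<close> \<open>M \<ge> 2\<close> by (simp add: abs_minus_commute)
  qed
  also have "m ^ d - v ^ d = v - u"
    by (simp add: u_def v_def f_def)
  also have "\<bar>v - u\<bar> \<le> M + \<bar>u\<bar>" by (simp add: M_def)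
  finally have "M ^ (d - 1) \<le> \<bar>u\<bar>" by simp
  then have "(M ^ (d - 1))\<^sup>2 \<le> u\<^sup>2"
    using \<open>M \<ge> 2\<close> abs_le_square_iff[of "M ^ (d - 1)" u] by simp
  moreover have "M ^ d < (M ^ (d - 1))\<^sup>2"
    using d \<open>M \<ge> 2\<close> by (simp flip: power_mult) 
  moreover have "\<bar>c\<bar> \<le> \<bar>u\<bar> + M ^ d"
  proof -
    have "\<bar>v ^ d\<bar> \<le> M ^ d"
      by (simp add: power_abs M_def power_mono)
    moreover have "c = u - v ^ d" by (simp add: u_def f_def)
    ultimately show ?thesis by linarith
  qed
  ultimately show False using bound(1) by linarith
qed

section \<open>Compositions of unicritical polynomials\<close>

text \<open>After translating the variable by \<open>c\<close>, the constant term of \<open>F(x + c)\<close> is the value of \<open>F\<close> at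
the critical value \<open>c\<close> of \<open>x ^ d + c\<close>, so irreducibility of the composition becomes a condition
on one rational number.\<close>

lemma irreducible_pcompose_unicritical:
  assumes F: "irreducible F" "lead_coeff F = 1" and "odd d"
    and nonpower: "\<And>q r. prime q \<Longrightarrow> q dvd d \<Longrightarrow> poly F (of_int c) \<noteq> r ^ q"
  shows "irreducible (pcompose F (unicritical d c))"
proof -
  define H where "H = pcompose F [:of_int c, 1:]"
  have "unicritical d c = pcompose [:of_int c, 1:] (monom 1 d)"
    by (simp add: unicritical_def pcompose_pCons)
  then have "pcompose F (unicritical d c) = pcompose H (monom 1 d)"
    by (simp add: H_def pcompose_assoc)
  moreover have "irreducible H"
    unfolding H_def using F(1) by (rule irreducible_pcompose_translation)
  moreover have "lead_coeff H = 1"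
    unfolding H_def using F(2) by (subst lead_coeff_comp) simp_all
  moreover have "coeff H 0 = poly F (of_int c)"
    by (simp add: H_def pcompose_coeff_0)
  ultimately show ?thesis
    using irreducible_pcompose_power[of H d] \<open>odd d\<close> nonpower by simp
qed

lemma degree_unicritical:
  assumes "d > 0"
  shows "degree (unicritical d c) = d"
  using assms by (simp add: unicritical_def degree_add_eq_left degree_monom_eq)

lemma lead_coeff_unicritical:
  assumes "d > 0"
  shows "lead_coeff (unicritical d c) = 1"
  using assms by (simp add: degree_unicritical) (simp add: unicritical_def coeff_pCons split: nat.split)

lemma poly_unicritical_of_int:
  "poly (unicritical d c) (of_int m) = of_int (m ^ d + c)"
  by (simp add: unicritical_def poly_monom)

lemma algebraic_int_rat_is_int:
  fixes r :: rat
  assumes "algebraic_int r"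
  obtains z where "r = of_int z"
proof -
  have "of_rat r \<in> (\<rat> :: rat set)" by (rule Rats_of_rat)
  then have "r \<in> \<rat>" by (simp add: of_rat_eq_id)
  then have "r \<in> \<int>" by (rule rational_algebraic_int_is_int[OF assms])
  then show ?thesis using that by (auto elim: Ints_cases)
qed

lemma rational_root_of_int_power:
  fixes r :: rat
  assumes "of_int k = r ^ q" "q > 0"
  obtains z where "k = z ^ q"
proof -
  have "algebraic_int r"
  proof (rule algebraic_int_root[where p = "monom 1 q"])
    show "algebraic_int (of_int k :: rat)" by simp
  qed (use assms in \<open>auto simp: poly_monom degree_monom_eq\<close>)
  then obtain z where "r = of_int z" by (rule algebraic_int_rat_is_int)
  then have "(of_int k :: rat) = of_int (z ^ q)" using assms(1) by simp
  then show ?thesis using that by (metis of_int_eq_iff)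
qed

text \<open>All integer arguments are considered, not just the critical values \<open>c\<close> that the irreducibility
  criterion asks for, because in this form the property survives composition.\<close>

definition avoids_prime_powers :: "nat \<Rightarrow> rat poly \<Rightarrow> bool" where
  "avoids_prime_powers d F \<longleftrightarrow>
     (\<forall>m::int. \<forall>q r. prime q \<longrightarrow> q dvd d \<longrightarrow> poly F (of_int m) \<noteq> r ^ q)"

text \<open>Composing on the right with some \<open>x ^ d + c\<close> only restricts the set of values at integers, so the
three properties together are inherited along the whole semigroup.\<close>

lemma irreducible_pcompose_semigroup:
  assumes "odd d" and S: "S \<subseteq> range (unicritical d)" and "g \<in> comp_semigroup S"
    and "irreducible F" "lead_coeff F = 1" "avoids_prime_powers d F"
  shows "irreducible (pcompose F g) \<and> lead_coeff (pcompose F g) = 1 \<and>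
    avoids_prime_powers d (pcompose F g)"
  using assms(3-)
proof (induction arbitrary: F rule: comp_semigroup.induct)
  case (generator f)
  obtain c where f: "f = unicritical d c" using generator(1) S by auto
  have "d > 0" using \<open>odd d\<close> by (rule odd_pos)
  have "irreducible (pcompose F f)"
    unfolding f using generator(2-) \<open>odd d\<close>
    by (intro irreducible_pcompose_unicritical) (auto simp: avoids_prime_powers_def)
  moreover have "lead_coeff (pcompose F f) = 1"
    using generator(3) degree_unicritical[OF \<open>d > 0\<close>] lead_coeff_unicritical[OF \<open>d > 0\<close>, of c] \<open>d > 0\<close>
    unfolding f by (subst lead_coeff_comp) simp_all
  moreover have "avoids_prime_powers d (pcompose F f)"
    using generator(4)
    by (simp add: avoids_prime_powers_def f poly_pcompose poly_unicritical_of_int del: of_int_add of_int_power)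
  ultimately show ?case by blast
next
  case (comp f g)
  from comp.IH(1)[OF comp.prems] show ?case
    using comp.IH(2)[of "pcompose F f"] by (simp add: pcompose_assoc)
qed

section \<open>Irreducible sets from a powered fixed point\<close>

theorem proposition3p7:
  fixes d s p :: nat
    and c :: "nat \<Rightarrow> int"
    and f :: "nat \<Rightarrow> rat poly"
    and G :: "rat poly set"
    and y :: rat
  assumes "d \<ge> 3" and "odd d" and "s \<ge> 2"
    and "inj_on c {1..s}"
    and "\<And>i. f i = unicritical d (c i)"
    and "G = comp_semigroup (f ` {1..s})"
    and "irreducible (f 1)"
    and "prime p" and "p dvd d" and "poly (f 1) (y ^ p) = y ^ p"
    and "of_int (c 2) \<noteq> y ^ p"
  shows "(c 2 = 0 \<longrightarrow>
            (\<forall>h \<in> {pcompose (pcompose_power (f 1) 3) (pcompose (f 2) (pcompose (f 1) g)) | g. g \<in> G}.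
               irreducible h))
       \<and> (c 2 \<noteq> 0 \<longrightarrow>
            (\<forall>h \<in> {pcompose (pcompose_power (f 1) 3) (pcompose (pcompose_power (f 2) 3) g) | g. g \<in> G}.
               irreducible h))"
proof -
  have "d > 0" "d > 1" using assms(1) by auto
  have "p \<ge> 2" using assms(8) by (rule prime_ge_2_nat)
  have f_monic: "lead_coeff (f i) = 1" and f_deg: "degree (f i) = d" for i
    using lead_coeff_unicritical[OF \<open>d > 0\<close>] degree_unicritical[OF \<open>d > 0\<close>] by (simp_all add: assms(5))
  have f_val: "poly (f i) (of_int m) = of_int (m ^ d + c i)" for i m
    by (simp only: assms(5) poly_unicritical_of_int)
  have "c 1 \<noteq> c 2"
    using assms(3,4) by (auto dest: inj_onD)

  \<comment> \<open>The fixed point equation makes \<open>y\<close> a root of the monic integer polynomial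
    \<open>x ^ (d * p) - x ^ p + c 1\<close>, so the problem is one about integers.\<close>
  have "algebraic_int y"
  proof (rule algebraic_int.intros)
    define h where "h = monom 1 (d * p) + ([:of_int (c 1):] - monom 1 p :: rat poly)"
    have "degree ([:of_int (c 1):] - monom 1 p :: rat poly) \<le> p"
      by (intro degree_diff_le) (simp_all add: degree_monom_eq)
    also have "p < d * p" using \<open>d > 1\<close> \<open>p \<ge> 2\<close> by simp
    finally have deg: "degree ([:of_int (c 1):] - monom 1 p :: rat poly) < degree (monom 1 (d * p) :: rat poly)"
      by (simp add: degree_monom_eq)
    show "lead_coeff h = 1"
      using deg coeff_eq_0[OF deg]
      by (simp add: h_def degree_add_eq_left degree_monom_eq)
    show "\<forall>i. coeff h i \<in> \<int>"
      by (auto simp: h_def coeff_pCons split: nat.split)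
    show "poly h y = 0"
      using assms(10) by (simp add: h_def assms(5) unicritical_def poly_monom mult.commute[of d] power_mult)
  qed
  then obtain Y where Y: "y = of_int Y" by (rule algebraic_int_rat_is_int)
  define P where "P = Y ^ p"
  have yP: "y ^ p = of_int P" by (simp add: Y P_def)
  have c1: "c 1 = P - P ^ d"
    using assms(10) by (simp add: yP f_val del: of_int_add of_int_power)
  have "c 2 \<noteq> P" using assms(11) by (simp add: yP)
  \<comment> \<open>Irreducibility of \<open>f 1\<close> excludes \<open>c 1 = 0\<close>, that is, the fixed points 0, 1 and -1.\<close>
  have "c 1 \<noteq> 0"
  proof
    assume "c 1 = 0"
    then have "f 1 = monom 1 1 * monom 1 (d - 1)"
      using \<open>d > 0\<close> by (simp add: assms(5) unicritical_def mult_monom)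
    then have "(monom 1 1 :: rat poly) dvd 1 \<or> (monom 1 (d - 1) :: rat poly) dvd 1"
      using assms(7) irreducibleD by blast
    then show False
      using \<open>d > 1\<close> by (simp add: is_unit_iff_degree degree_monom_eq)
  qed
  have P: "\<bar>P\<bar> \<ge> 2"
  proof (rule ccontr)
    assume "\<not> \<bar>P\<bar> \<ge> 2"
    then have "P = 0 \<or> P = 1 \<or> P = -1" by auto
    with \<open>c 1 \<noteq> 0\<close> c1 \<open>d > 0\<close> assms(2) show False by auto
  qed
  have absY: "\<bar>Y\<bar> \<ge> 2"
  proof (rule ccontr)
    assume "\<not> \<bar>Y\<bar> \<ge> 2"
    then have "\<bar>Y\<bar> ^ p \<le> 1" by (intro power_le_one) auto
    with P show False by (simp add: P_def power_abs)
  qed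
  have c1_large: "\<bar>c 1\<bar> \<ge> 2"
    using fixed_point_size(3)[OF assms(1) P] P unfolding c1 by linarith

  define F3 where "F3 = pcompose (pcompose (f 1) (f 1)) (f 1)"
  have extend: "irreducible (pcompose F (f i)) \<and> lead_coeff (pcompose F (f i)) = 1"
    if "irreducible F" "lead_coeff F = 1" "poly F (of_int (c i)) = of_int k"
      "\<And>q z. prime q \<Longrightarrow> q dvd d \<Longrightarrow> k \<noteq> z ^ q" for F i k
  proof
    have "poly F (of_int (c i)) \<noteq> r ^ q" if q: "prime q" "q dvd d" for q r
    proof
      assume "poly F (of_int (c i)) = r ^ q"
      then have "of_int k = r ^ q" by (simp add: \<open>poly F (of_int (c i)) = of_int k\<close>)
      then obtain z where "k = z ^ q"
        using prime_gt_0_nat[OF q(1)] by (rule rational_root_of_int_power)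
      with q show False using \<open>\<And>q z. prime q \<Longrightarrow> q dvd d \<Longrightarrow> k \<noteq> z ^ q\<close> by blast
    qed
    then show "irreducible (pcompose F (f i))"
      using that(1,2) assms(2) unfolding assms(5) by (intro irreducible_pcompose_unicritical)
    show "lead_coeff (pcompose F (f i)) = 1"
      using that(2) f_monic[of i] f_deg[of i] \<open>d > 0\<close> by (subst lead_coeff_comp) simp_all
  qed
  have F3_val: "poly F3 (of_int n) = of_int (((n ^ d + c 1) ^ d + c 1) ^ d + c 1)" for n
    by (simp only: F3_def poly_pcompose f_val)
  have F3_nonpower: "((n ^ d + c 1) ^ d + c 1) ^ d + c 1 \<noteq> z ^ q"
    if "n \<noteq> P" "prime q" "q dvd d" for n q z
    unfolding c1 using third_iterate_not_prime_power[OF assms(2,1) P that] .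
  have F3: "irreducible F3 \<and> lead_coeff F3 = 1"
  proof -
    have f1f1: "irreducible (pcompose (f 1) (f 1)) \<and> lead_coeff (pcompose (f 1) (f 1)) = 1"
      using critical_value_not_prime_power[OF assms(2)] c1_large \<open>c 1 \<noteq> 0\<close>
      by (intro extend[OF assms(7) f_monic f_val]) blast
    \<comment> \<open>Since \<open>c 1\<close> is the image of 0, its second iterate is the third iterate of \<open>0 \<noteq> P\<close>.\<close>
    have val: "poly (pcompose (f 1) (f 1)) (of_int (c 1)) =
        of_int (((0 ^ d + c 1) ^ d + c 1) ^ d + c 1)"
      using \<open>d > 0\<close> by (simp only: poly_pcompose f_val) (simp add: power_0_left)
    have "0 \<noteq> P" using P by auto
    show ?thesis
      unfolding F3_def using f1f1 F3_nonpower[OF \<open>0 \<noteq> P\<close>] by (intro extend[OF _ _ val]) blast+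
  qed
  \<comment> \<open>When \<open>F\<close> is \<open>F3\<close> after an inner map, a further composition with \<open>f i\<close> can only be
    obstructed by an inner map that sends \<open>c i\<close> to \<open>P\<close>.\<close>
  have extend_F3: "irreducible (pcompose F (f i)) \<and> lead_coeff (pcompose F (f i)) = 1"
    if "irreducible F \<and> lead_coeff F = 1" "poly F (of_int (c i)) = poly F3 (of_int n)" "n \<noteq> P" for F i n
    using that F3_nonpower[OF that(3)] by (intro extend[of F i]) (auto simp: F3_val)
  have avoids: "avoids_prime_powers d F"
    if vals: "\<And>m. \<exists>n. n \<noteq> P \<and> poly F (of_int m) = poly F3 (of_int n)" for F
    unfolding avoids_prime_powers_def
  proof (intro allI impI notI)
    fix m q r
    assume q: "prime q" "q dvd d" and "poly F (of_int m) = r ^ q"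
    moreover obtain n where n: "n \<noteq> P" "poly F (of_int m) = poly F3 (of_int n)"
      using vals by blast
    ultimately have "of_int (((n ^ d + c 1) ^ d + c 1) ^ d + c 1) = r ^ q"
      by (simp only: F3_val)
    then obtain z where "((n ^ d + c 1) ^ d + c 1) ^ d + c 1 = z ^ q"
      using prime_gt_0_nat[OF q(1)] by (rule rational_root_of_int_power)
    with F3_nonpower[OF n(1) q] show False by blast
  qed
  have semigroup: "irreducible (pcompose F g)"
    if "irreducible F \<and> lead_coeff F = 1" "avoids_prime_powers d F" "g \<in> G" for F g
    using irreducible_pcompose_semigroup[of d "f ` {1..s}" g F] that assms(2,5,6) by auto
  have F32: "irreducible (pcompose F3 (f 2)) \<and> lead_coeff (pcompose F3 (f 2)) = 1"
    using F3 \<open>c 2 \<noteq> P\<close> by (intro extend_F3[of _ _ "c 2"]) auto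
  have power3: "pcompose_power (f i) 3 = pcompose (pcompose (f i) (f i)) (f i)" for i
    by (simp add: pcompose_power_def numeral_3_eq_3 pcompose_assoc)

  have "irreducible (pcompose (pcompose_power (f 1) 3) (pcompose (f 2) (pcompose (f 1) g)))"
    if "c 2 = 0" "g \<in> G" for g
  proof -
    have not_P: "(m ^ d + c 1) ^ d + c 2 \<noteq> P" for m
      using fixed_point_not_power_of_value[OF assms(2,1) P] unfolding c1 \<open>c 2 = 0\<close> by simp
    have "irreducible (pcompose (pcompose F3 (f 2)) (f 1)) \<and>
        lead_coeff (pcompose (pcompose F3 (f 2)) (f 1)) = 1"
    proof (rule extend_F3[OF F32])
      show "poly (pcompose F3 (f 2)) (of_int (c 1)) = poly F3 (of_int ((0 ^ d + c 1) ^ d + c 2))"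
        using \<open>d > 0\<close> by (simp only: poly_pcompose f_val) (simp add: power_0_left)
    qed (rule not_P)
    moreover have "avoids_prime_powers d (pcompose (pcompose F3 (f 2)) (f 1))"
      using not_P by (intro avoids) (simp only: poly_pcompose f_val, blast)
    ultimately have "irreducible (pcompose (pcompose (pcompose F3 (f 2)) (f 1)) g)"
      using \<open>g \<in> G\<close> by (rule semigroup)
    then show ?thesis by (simp add: power3 F3_def pcompose_assoc)
  qed
  moreover have "irreducible (pcompose (pcompose_power (f 1) 3) (pcompose (pcompose_power (f 2) 3) g))"
    if "c 2 \<noteq> 0" "g \<in> G" for g
  proof -
    \<comment> \<open>\<open>P\<close> is a fixed point of \<open>f 1\<close>, hence not of \<open>f 2\<close>.\<close>
    have "P ^ d + c 2 \<noteq> P" using \<open>c 1 \<noteq> c 2\<close> c1 by simp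
    then have not_P: "((m ^ d + c 2) ^ d + c 2) ^ d + c 2 \<noteq> P" for m
      unfolding P_def
      using fixed_point_not_third_iterate[OF assms(2,1) absY assms(8,9) \<open>c 2 \<noteq> 0\<close>] by blast
    have crit: "c 2 ^ d + c 2 \<noteq> P"
      unfolding P_def using critical_value_not_prime_power assms(2,8,9) absY \<open>c 2 \<noteq> 0\<close> by blast
    have "irreducible (pcompose (pcompose F3 (f 2)) (f 2)) \<and>
        lead_coeff (pcompose (pcompose F3 (f 2)) (f 2)) = 1"
      by (rule extend_F3[OF F32 _ crit]) (simp only: poly_pcompose f_val)
    then have "irreducible (pcompose (pcompose (pcompose F3 (f 2)) (f 2)) (f 2)) \<and>
        lead_coeff (pcompose (pcompose (pcompose F3 (f 2)) (f 2)) (f 2)) = 1"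
    proof (rule extend_F3)
      show "poly (pcompose (pcompose F3 (f 2)) (f 2)) (of_int (c 2)) =
          poly F3 (of_int (((0 ^ d + c 2) ^ d + c 2) ^ d + c 2))"
        using \<open>d > 0\<close> by (simp only: poly_pcompose f_val) (simp add: power_0_left)
    qed (rule not_P)
    moreover have "avoids_prime_powers d (pcompose (pcompose (pcompose F3 (f 2)) (f 2)) (f 2))"
      using not_P by (intro avoids) (simp only: poly_pcompose f_val, blast)
    ultimately have "irreducible (pcompose (pcompose (pcompose (pcompose F3 (f 2)) (f 2)) (f 2)) g)"
      using \<open>g \<in> G\<close> by (rule semigroup)
    then show ?thesis by (simp add: power3 F3_def pcompose_assoc)
  qed
  ultimately show ?thesis by blast
qed

end
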